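(* Let $n\ge1$, let $\Phi$ be the root system of type $A_n$, and let $C\mapsto F_C$ be the bijection (described in the context) from the set $\mathcal B(\Phi)$ of biclosed sets in $\Phi$ to the set $F_{n+1}$ of quasitrivial semigroup structures on $X_{n+1}=\{1,\dots,n+1\}$. Let $\leq$ be the relation on $F_{n+1}$ defined in the context. Let $C_1,C_2$ be two biclosed sets in $\Phi$. Then $C_1\subset C_2$ if and only if $F_{C_1}\leq F_{C_2}$. Therefore $(F_{n+1},\leq)$ is a well-defined poset isomorphic to $(\mathcal B(\Phi),\subset)$.
   Context: Root system of type $A_n$: $V$ is a real vector space with basis $\Delta=\{\alpha_1,\dots,\alpha_n\}$, $\Phi=\{\pm(\alpha_i+\cdots+\alpha_k):1\le i\le k\le n\}$, $\Phi^+=\{\alpha_i+\cdots+\alpha_k:1\le i\le k\le n\}$. The bilinear form is $(\alpha_i,\alpha_i)=1$, $(\alpha_i,\alpha_j)=-\frac12$ if $|i-j|=1$, and $0$ if $|i-j|\ge2$. For $1\le j\le k\le n$ put $\alpha_{j,k+1}=\alpha_j+\cdots+\alpha_k$, $\alpha_{k+1,j}=-\alpha_{j,k+1}$. $W=S_{n+1}$ acts on $\Phi$ by $w\alpha_{a,b}=\alpha_{w(a),w(b)}$. $C\subset\Phi$ is closed if $\alpha,\beta\in C$, $\alpha+\beta\in\Phi$ imply $\alpha+\beta\in C$; $C$ is biclosed if $C$ and $\Phi\setminus C$ are closed. For orthogonal $\Delta_1,\Delta_2\subset\Delta$ put $\Phi^+_{\Delta_1,\Delta_2}=(\Phi^+\setminus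 \mathrm{span}_{\mathbb R}(\Delta_1))\cup(\mathrm{span}_{\mathbb R}(\Delta_2)\cap\Phi)$. It is known that the biclosed sets in $\Phi$ are exactly the sets $w\Phi^+_{\Delta_1,\Delta_2}$ with $w\in W$ and $\Delta_1,\Delta_2\subset\Delta$ orthogonal. $F_{n+1}$ is the set of associative maps $F:X_{n+1}\times X_{n+1}\to X_{n+1}$ with $F(a,b)\in\{a,b\}$ for all $a,b$. The bijection $C\mapsto F_C$: write $C=\sigma(\Phi^+_{\Delta_1,\Delta_2})$. Decompose $\{1,\dots,n+1\}$ into consecutive intervals by putting $i$ and $i+1$ in the same interval iff $\alpha_i\in\Delta_1\cup\Delta_2$; order the intervals from left to right. The images under $\sigma$ of the intervals are the equivalence classes of a total preorder $\precsim$ on $X_{n+1}$, ordered as the intervals are. For an interval $\{i,\dots,i+k\}$ with $k\ge1$, the roots $\alpha_i,\dots,\alpha_{i+k-1}$ all lie in $\Delta_1$ or all lie in $\Delta_2$. Then $F_C(x,y)$ is the $\precsim$-greater of $x,y$ if $x\nsim y$; if $x\sim y$, then $F_C(x,y)=x$ when the class comes from $\Delta_1$ and $F_C(x,y)=y$ when it comes from $\Delta_2$ (and $F_C(x,x)=x$). This is well defined and bijective. The relation $\le$: on a two-element set $\{a,b\}$ of natural numbers there are exactly four quasitrivial semigroup structures: $\pi_1$ (first projection), $\max$, $\min$ (for the usual order of natural numbers) and $\pi_2$ (second projection). Partially order them by $\pi_1<\max$, $\pi_1<\min$, $\pi_1<\pi_2$, $\max<\pi_2$, $\min<\pi_2$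 (with $\max,\min$ incomparable). For $F,F'\in F_{n+1}$ set $F\le F'$ if and only if $F|_{\{a,b\}}\le F'|_{\{a,b\}}$ for all $a\ne b$ in $X_{n+1}$. *)

theory Defs
  imports "HOL-Analysis.Analysis"
begin

section \<open>The root system of type A\<close>

text \<open>The vector space is the whole type, the simple roots are \<open>\<alpha> 1, \<dots>, \<alpha> n\<close> (the values of
  \<open>\<alpha>\<close> at other indices play no role), and \<open>form\<close> is the bilinear form.\<close>

locale root_system_A =
  fixes n :: nat
    and \<alpha> :: "nat \<Rightarrow> 'v::real_vector"
    and form :: "'v \<Rightarrow> 'v \<Rightarrow> real"
  assumes rank_pos: "1 \<le> n"
    and inj_simple: "inj_on \<alpha> {1..n}"
    and independent_simple: "independent (\<alpha> ` {1..n})"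
    and span_simple: "span (\<alpha> ` {1..n}) = UNIV"
    and bilinear_form: "bilinear form"
    and form_same: "i \<in> {1..n} \<Longrightarrow> form (\<alpha> i) (\<alpha> i) = 1"
    and form_adjacent:
      "\<lbrakk>i \<in> {1..n}; j \<in> {1..n}; \<bar>int i - int j\<bar> = 1\<rbrakk> \<Longrightarrow> form (\<alpha> i) (\<alpha> j) = - 1 / 2"
    and form_distant:
      "\<lbrakk>i \<in> {1..n}; j \<in> {1..n}; \<bar>int i - int j\<bar> \<ge> 2\<rbrakk> \<Longrightarrow> form (\<alpha> i) (\<alpha> j) = 0"

definition pos_roots :: "nat \<Rightarrow> (nat \<Rightarrow> 'v::real_vector) \<Rightarrow> 'v set" where
  "pos_roots n \<alpha> = {\<Sum>l=i..k. \<alpha> l | i k. 1 \<le> i \<and> i \<le> k \<and> k \<le> n}"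

definition roots :: "nat \<Rightarrow> (nat \<Rightarrow> 'v::real_vector) \<Rightarrow> 'v set" where
  "roots n \<alpha> = pos_roots n \<alpha> \<union> uminus ` pos_roots n \<alpha>"

definition pts :: "nat \<Rightarrow> nat set" where
  "pts n = {1..n + 1}"

text \<open>The root \<open>\<alpha>\<^bsub>a,b\<^esub>\<close>, meaningful for distinct \<open>a\<close>, \<open>b\<close> in \<open>pts n\<close>.\<close>

definition root_ab :: "(nat \<Rightarrow> 'v::real_vector) \<Rightarrow> nat \<Rightarrow> nat \<Rightarrow> 'v" where
  "root_ab \<alpha> a b = (if a < b then \<Sum>l=a..<b. \<alpha> l else - (\<Sum>l=b..<a. \<alpha> l))"

text \<open>The image \<open>w S\<close> of a set of roots under the action \<open>w \<alpha>\<^bsub>a,b\<^esub> = \<alpha>\<^bsub>w(a),w(b)\<^esub>\<close>.\<close>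

definition weyl_image ::
  "nat \<Rightarrow> (nat \<Rightarrow> 'v::real_vector) \<Rightarrow> (nat \<Rightarrow> nat) \<Rightarrow> 'v set \<Rightarrow> 'v set" where
  "weyl_image n \<alpha> w S =
     {root_ab \<alpha> (w a) (w b) | a b. a \<in> pts n \<and> b \<in> pts n \<and> a \<noteq> b \<and> root_ab \<alpha> a b \<in> S}"

definition closed_roots :: "nat \<Rightarrow> (nat \<Rightarrow> 'v::real_vector) \<Rightarrow> 'v set \<Rightarrow> bool" where
  "closed_roots n \<alpha> C \<longleftrightarrow>
     C \<subseteq> roots n \<alpha> \<and> (\<forall>\<beta>\<in>C. \<forall>\<gamma>\<in>C. \<beta> + \<gamma> \<in> roots n \<alpha> \<longrightarrow> \<beta> + \<gamma> \<in> C)"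

definition biclosed_sets :: "nat \<Rightarrow> (nat \<Rightarrow> 'v::real_vector) \<Rightarrow> 'v set set" where
  "biclosed_sets n \<alpha> =
     {C. C \<subseteq> roots n \<alpha> \<and> closed_roots n \<alpha> C \<and> closed_roots n \<alpha> (roots n \<alpha> - C)}"

definition orthogonal_simple ::
  "nat \<Rightarrow> (nat \<Rightarrow> 'v::real_vector) \<Rightarrow> ('v \<Rightarrow> 'v \<Rightarrow> real) \<Rightarrow> 'v set \<Rightarrow> 'v set \<Rightarrow> bool" where
  "orthogonal_simple n \<alpha> form \<Delta>1 \<Delta>2 \<longleftrightarrow>
     \<Delta>1 \<subseteq> \<alpha> ` {1..n} \<and> \<Delta>2 \<subseteq> \<alpha> ` {1..n} \<and> (\<forall>\<beta>\<in>\<Delta>1. \<forall>\<gamma>\<in>\<Delta>2. form \<beta> \<gamma> = 0)"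

definition std_biclosed ::
  "nat \<Rightarrow> (nat \<Rightarrow> 'v::real_vector) \<Rightarrow> 'v set \<Rightarrow> 'v set \<Rightarrow> 'v set" where
  "std_biclosed n \<alpha> \<Delta>1 \<Delta>2 = (pos_roots n \<alpha> - span \<Delta>1) \<union> (span \<Delta>2 \<inter> roots n \<alpha>)"


section \<open>Quasitrivial semigroup structures\<close>

text \<open>A binary operation on \<open>S\<close> is an extensional function on \<open>S \<times> S\<close>, so that
  equality of operations is equality of functions.\<close>

definition quasitrivial_semigroups :: "nat set \<Rightarrow> (nat \<times> nat \<Rightarrow> nat) set" where
  "quasitrivial_semigroups S =
     {F \<in> (S \<times> S) \<rightarrow>\<^sub>E S.
        (\<forall>a\<in>S. \<forall>b\<in>S. \<forall>c\<in>S. F (F (a, b), c) = F (a, F (b, c))) \<and>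
        (\<forall>a\<in>S. \<forall>b\<in>S. F (a, b) \<in> {a, b})}"

definition proj1_on :: "nat set \<Rightarrow> nat \<times> nat \<Rightarrow> nat" where
  "proj1_on S = restrict (\<lambda>(x, y). x) (S \<times> S)"

definition proj2_on :: "nat set \<Rightarrow> nat \<times> nat \<Rightarrow> nat" where
  "proj2_on S = restrict (\<lambda>(x, y). y) (S \<times> S)"

definition max_on :: "nat set \<Rightarrow> nat \<times> nat \<Rightarrow> nat" where
  "max_on S = restrict (\<lambda>(x, y). max x y) (S \<times> S)"

definition min_on :: "nat set \<Rightarrow> nat \<times> nat \<Rightarrow> nat" where
  "min_on S = restrict (\<lambda>(x, y). min x y) (S \<times> S)"

text \<open>The reflexive order on the four structures on a two-element set \<open>S\<close>. An operation that is
  not one of the four is not related to itself.\<close>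

definition two_point_order :: "nat set \<Rightarrow> ((nat \<times> nat \<Rightarrow> nat) \<times> (nat \<times> nat \<Rightarrow> nat)) set" where
  "two_point_order S =
     Id_on {proj1_on S, max_on S, min_on S, proj2_on S} \<union>
     {(proj1_on S, max_on S), (proj1_on S, min_on S), (proj1_on S, proj2_on S),
      (max_on S, proj2_on S), (min_on S, proj2_on S)}"

definition qt_le :: "nat \<Rightarrow> (nat \<times> nat \<Rightarrow> nat) \<Rightarrow> (nat \<times> nat \<Rightarrow> nat) \<Rightarrow> bool" where
  "qt_le n F F' \<longleftrightarrow>
     (\<forall>a\<in>pts n. \<forall>b\<in>pts n. a \<noteq> b \<longrightarrow>
        (restrict F ({a, b} \<times> {a, b}), restrict F' ({a, b} \<times> {a, b})) \<in> two_point_order {a, b})"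


section \<open>From biclosed sets to quasitrivial semigroups\<close>

text \<open>The block containing \<open>i\<close> of the decomposition of \<open>{1..n + 1}\<close> into intervals in which
  \<open>k\<close> and \<open>k + 1\<close> lie together iff \<open>\<alpha> k \<in> D\<close>; below \<open>D = \<Delta>1 \<union> \<Delta>2\<close>.\<close>

definition block :: "nat \<Rightarrow> (nat \<Rightarrow> 'v) \<Rightarrow> 'v set \<Rightarrow> nat \<Rightarrow> nat set" where
  "block n \<alpha> D i = {j \<in> pts n. \<forall>k. min i j \<le> k \<and> k < max i j \<longrightarrow> \<alpha> k \<in> D}"

text \<open>The total preorder on \<open>pts n\<close> whose classes are the images of the blocks under \<open>\<sigma>\<close>,
  ordered as the blocks are.\<close>

definition block_preorder ::
  "nat \<Rightarrow> (nat \<Rightarrow> 'v) \<Rightarrow> 'v set \<Rightarrow> (nat \<Rightarrow> nat) \<Rightarrow> nat \<Rightarrow> nat \<Rightarrow> bool" where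
  "block_preorder n \<alpha> D \<sigma> x y \<longleftrightarrow>
     (\<exists>i\<in>pts n. \<exists>j\<in>pts n. x = \<sigma> i \<and> y = \<sigma> j \<and> (i \<le> j \<or> block n \<alpha> D i = block n \<alpha> D j))"

text \<open>A class comes from \<open>\<Delta>1\<close> if the simple roots inside its block lie in \<open>\<Delta>1\<close>; for
  orthogonal \<open>\<Delta>1\<close>, \<open>\<Delta>2\<close> those of a non-singleton block otherwise all lie in \<open>\<Delta>2\<close>. Singleton
  blocks count as coming from \<open>\<Delta>1\<close>, which is harmless as then \<open>x = y\<close>.\<close>

definition qt_of_data ::
  "nat \<Rightarrow> (nat \<Rightarrow> 'v) \<Rightarrow> 'v set \<Rightarrow> 'v set \<Rightarrow> (nat \<Rightarrow> nat) \<Rightarrow> nat \<times> nat \<Rightarrow> nat" where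
  "qt_of_data n \<alpha> \<Delta>1 \<Delta>2 \<sigma> =
     restrict (\<lambda>(x, y).
       let le = block_preorder n \<alpha> (\<Delta>1 \<union> \<Delta>2) \<sigma>;
           I = block n \<alpha> (\<Delta>1 \<union> \<Delta>2) (inv \<sigma> x)
       in if le x y \<and> le y x
          then (if \<forall>k. k \<in> I \<and> k + 1 \<in> I \<longrightarrow> \<alpha> k \<in> \<Delta>1 then x else y)
          else (if le x y then y else x))
     (pts n \<times> pts n)"

text \<open>\<open>F\<^bsub>C\<^esub>\<close>: the operation obtained from any presentation \<open>C = \<sigma> \<Phi>\<^sup>+\<^bsub>\<Delta>1,\<Delta>2\<^esub>\<close>.\<close>

definition qt_of_biclosed ::
  "nat \<Rightarrow> (nat \<Rightarrow> 'v::real_vector) \<Rightarrow> ('v \<Rightarrow> 'v \<Rightarrow> real) \<Rightarrow> 'v set \<Rightarrow> nat \<times> nat \<Rightarrow> nat" where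
  "qt_of_biclosed n \<alpha> form C =
     (THE F. \<exists>\<sigma> \<Delta>1 \<Delta>2. \<sigma> permutes pts n \<and> orthogonal_simple n \<alpha> form \<Delta>1 \<Delta>2 \<and>
        C = weyl_image n \<alpha> \<sigma> (std_biclosed n \<alpha> \<Delta>1 \<Delta>2) \<and> F = qt_of_data n \<alpha> \<Delta>1 \<Delta>2 \<sigma>)"

end

theory Submission
  imports Defs "HOL-Combinatorics.Permutations"
begin

text \<open>For distinct points \<open>x\<close>, \<open>y\<close> one has \<open>F\<^bsub>C\<^esub>(x, y) = y\<close> exactly when \<open>\<alpha>\<^bsub>x,y\<^esub> \<in> C\<close>, whatever
  presentation of \<open>C\<close> is used. Since \<open>\<alpha>\<^bsub>a,b\<^esub> + \<alpha>\<^bsub>b,c\<^esub> = \<alpha>\<^bsub>a,c\<^esub>\<close> are the only additive relations among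
  roots, \<open>C\<close> is biclosed iff the relation \<open>\<alpha>\<^bsub>x,y\<^esub> \<in> C\<close> and its complement are transitive on
  triples of distinct points, and this is precisely associativity of \<open>F\<^bsub>C\<^esub>\<close>. On a two-element
  set the order of the four structures is the componentwise order of the truth values of
  \<open>F(a, b) = b\<close> and \<open>F(b, a) = a\<close>, which turns inclusion into \<open>\<le>\<close>. A presentation of a biclosed set
  is found by sorting the points according to the number of points strictly below them in
  the associated total preorder.\<close>

section \<open>Roots and coordinates\<close>

text \<open>The condition inside \<open>block\<close>, separated from membership in
  \<open>pts n\<close>: it is an equivalence relation whose classes, cut down to
  \<open>pts n\<close>, are the blocks.\<close>

definition linked :: "(nat \<Rightarrow> 'v) \<Rightarrow> 'v set \<Rightarrow> nat \<Rightarrow> nat \<Rightarrow> bool" where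
  "linked \<alpha> D i j \<longleftrightarrow> (\<forall>k. min i j \<le> k \<and> k < max i j \<longrightarrow> \<alpha> k \<in> D)"

lemma linked_commute: "linked \<alpha> D i j \<longleftrightarrow> linked \<alpha> D j i"
  by (simp add: linked_def min.commute max.commute)

lemma linked_refl [simp]: "linked \<alpha> D i i"
  by (auto simp: linked_def)

lemma linked_trans:
  assumes "linked \<alpha> D i j" "linked \<alpha> D j k"
  shows "linked \<alpha> D i k"
  unfolding linked_def
proof (intro allI impI)
  fix l assume "min i k \<le> l \<and> l < max i k"
  then have "min i j \<le> l \<and> l < max i j \<or> min j k \<le> l \<and> l < max j k" by linarith
  then show "\<alpha> l \<in> D" using assms by (auto simp: linked_def)
qed

lemma block_eq_iff:
  assumes "i \<in> pts n" "j \<in> pts n"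
  shows "block n \<alpha> D i = block n \<alpha> D j \<longleftrightarrow> linked \<alpha> D i j"
proof -
  have b: "block n \<alpha> D i = {j \<in> pts n. linked \<alpha> D i j}" for i
    by (simp add: block_def linked_def)
  show ?thesis
  proof
    assume "block n \<alpha> D i = block n \<alpha> D j"
    moreover have "j \<in> block n \<alpha> D j" using assms by (simp add: b)
    ultimately have "j \<in> block n \<alpha> D i" by blast
    then show "linked \<alpha> D i j" by (simp add: b)
  next
    assume "linked \<alpha> D i j"
    then show "block n \<alpha> D i = block n \<alpha> D j"
      unfolding b using linked_trans linked_commute by blast
  qed
qed

text \<open>With partial sums as potentials the sign split in \<open>root_ab\<close> disappears and
  additivity becomes cancellation. The sums start at index 0; for indices in \<open>pts n\<close>
  the summand \<open>\<alpha> 0\<close> cancels.\<close>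

lemma root_ab_diff: "root_ab \<alpha> a b = (\<Sum>l<b. \<alpha> l) - (\<Sum>l<a. \<alpha> l)"
proof -
  have "(\<Sum>l=p..<q. \<alpha> l) = (\<Sum>l<q. \<alpha> l) - (\<Sum>l<p. \<alpha> l)" if "p \<le> q" for p q
    using sum_diff_nat_ivl[of 0 p q \<alpha>] that by (simp add: lessThan_atLeast0)
  then show ?thesis by (auto simp: root_ab_def)
qed

lemma root_ab_add: "root_ab \<alpha> a b + root_ab \<alpha> b c = root_ab \<alpha> a c"
  by (simp add: root_ab_diff)

lemma root_ab_minus: "- root_ab \<alpha> a b = root_ab \<alpha> b a"
  by (simp add: root_ab_diff)

lemma pos_roots_eq:
  "pos_roots n \<alpha> = {root_ab \<alpha> a b | a b. a \<in> pts n \<and> b \<in> pts n \<and> a < b}"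
proof (intro equalityI subsetI)
  fix x assume "x \<in> pos_roots n \<alpha>"
  then obtain i k where "x = (\<Sum>l=i..k. \<alpha> l)" "1 \<le> i" "i \<le> k" "k \<le> n"
    by (auto simp: pos_roots_def)
  then have "x = root_ab \<alpha> i (Suc k)" "i \<in> pts n" "Suc k \<in> pts n" "i < Suc k"
    by (auto simp: root_ab_def pts_def atLeastLessThanSuc_atLeastAtMost)
  then show "x \<in> {root_ab \<alpha> a b | a b. a \<in> pts n \<and> b \<in> pts n \<and> a < b}" by blast
next
  fix x assume "x \<in> {root_ab \<alpha> a b | a b. a \<in> pts n \<and> b \<in> pts n \<and> a < b}"
  then obtain a b where ab: "x = root_ab \<alpha> a b" "a \<in> pts n" "b \<in> pts n" "a < b" by blast
  then obtain k where "b = Suc k" by (cases b) auto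
  with ab have "x = (\<Sum>l=a..k. \<alpha> l)" "1 \<le> a" "a \<le> k" "k \<le> n"
    by (auto simp: root_ab_def pts_def atLeastLessThanSuc_atLeastAtMost)
  then show "x \<in> pos_roots n \<alpha>" unfolding pos_roots_def by blast
qed

lemma roots_eq:
  "roots n \<alpha> = {root_ab \<alpha> a b | a b. a \<in> pts n \<and> b \<in> pts n \<and> a \<noteq> b}"
proof -
  have "uminus ` pos_roots n \<alpha> = {root_ab \<alpha> b a | a b. a \<in> pts n \<and> b \<in> pts n \<and> a < b}"
    unfolding pos_roots_eq by (force simp: root_ab_minus image_iff)
  then show ?thesis
    unfolding roots_def pos_roots_eq by (auto simp: neq_iff)
qed

section \<open>Coordinate functionals and the recognition of roots\<close>

context root_system_A
begin

lemma linear_simple_exists: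
  fixes h :: "nat \<Rightarrow> real"
  shows "\<exists>f :: 'v \<Rightarrow> real. linear f \<and> (\<forall>l\<in>{1..n}. f (\<alpha> l) = h l)"
proof -
  \<comment> \<open>A linear map is prescribed on vectors, not on indices, so \<open>h\<close> is
    composed with the inverse of \<open>\<alpha>\<close> on \<open>{1..n}\<close>.\<close>
  obtain f :: "'v \<Rightarrow> real" where lin: "linear f"
    and f: "\<forall>x\<in>\<alpha> ` {1..n}. f x = h (inv_into {1..n} \<alpha> x)"
    using linear_independent_extend[OF independent_simple, of "\<lambda>x. h (inv_into {1..n} \<alpha> x)"] by auto
  have "f (\<alpha> l) = h l" if "l \<in> {1..n}" for l
    using bspec[OF f imageI[OF that]] by (simp only: inv_into_f_f[OF inj_simple that])
  with lin show ?thesis by blast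
qed

text \<open>The functional \<open>\<epsilon>\<close> is the \<open>c\<close>-th coordinate in the realisation
  \<open>\<alpha>\<^bsub>a,b\<^esub> = e\<^sub>a - e\<^sub>b\<close>.\<close>

lemma coordinate_exists:
  "\<exists>\<epsilon> :: 'v \<Rightarrow> real. linear \<epsilon> \<and>
    (\<forall>a\<in>pts n. \<forall>b\<in>pts n. \<epsilon> (root_ab \<alpha> a b) = of_bool (a = c) - of_bool (b = c))"
proof -
  obtain \<epsilon> :: "'v \<Rightarrow> real" where lin: "linear \<epsilon>"
    and \<epsilon>: "\<And>l. l \<in> {1..n} \<Longrightarrow> \<epsilon> (\<alpha> l) = of_bool (l = c) - of_bool (Suc l = c)"
    using linear_simple_exists[of "\<lambda>l. of_bool (l = c) - of_bool (Suc l = c)"] by blast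
  have up: "\<epsilon> (root_ab \<alpha> a b) = of_bool (a = c) - of_bool (b = c)"
    if "1 \<le> a" "a < b" "b \<le> n + 1" for a b
  proof -
    have "\<epsilon> (root_ab \<alpha> a b) = (\<Sum>l=a..<b. \<epsilon> (\<alpha> l))"
      using that by (simp add: root_ab_def linear_sum[OF lin])
    \<comment> \<open>The summand is brought to the form \<open>g (Suc l) - g l\<close> with
      \<open>g l = - of_bool (l = c)\<close>, so that the sum telescopes.\<close>
    also have "\<dots> = (\<Sum>l=a..<b. - of_bool (Suc l = c) - - of_bool (l = c))"
      by (rule sum.cong) (use that in \<open>auto simp: \<epsilon>\<close>)
    also have "\<dots> = of_bool (a = c) - of_bool (b = c)"
      by (subst sum_Suc_diff') (use that in auto)
    finally show ?thesis .
  qed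
  have "\<epsilon> (root_ab \<alpha> a b) = of_bool (a = c) - of_bool (b = c)"
    if "a \<in> pts n" "b \<in> pts n" for a b
  proof (cases a b rule: linorder_cases)
    case less
    with that up show ?thesis by (simp add: pts_def)
  next
    case equal
    with lin show ?thesis by (simp only: root_ab_diff diff_self linear_0)
  next
    case greater
    have "\<epsilon> (root_ab \<alpha> a b) = - \<epsilon> (root_ab \<alpha> b a)"
      by (metis root_ab_minus linear_neg[OF lin])
    with greater that up show ?thesis by (simp add: pts_def)
  qed
  with lin show ?thesis by blast
qed

lemma root_ab_eq_iff:
  assumes "a \<in> pts n" "b \<in> pts n" "a \<noteq> b" "c \<in> pts n" "d \<in> pts n"
  shows "root_ab \<alpha> a b = root_ab \<alpha> c d \<longleftrightarrow> a = c \<and> b = d"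
proof
  assume eq: "root_ab \<alpha> a b = root_ab \<alpha> c d"
  have e: "of_bool (a = e) - of_bool (b = e) = (of_bool (c = e) - of_bool (d = e) :: real)" for e
  proof -
    obtain \<epsilon> :: "'v \<Rightarrow> real" where
      "\<And>a b. a \<in> pts n \<Longrightarrow> b \<in> pts n \<Longrightarrow>
        \<epsilon> (root_ab \<alpha> a b) = of_bool (a = e) - of_bool (b = e)"
      using coordinate_exists[of e] by blast
    then show ?thesis using arg_cong[OF eq, of \<epsilon>] assms by simp
  qed
  \<comment> \<open>As \<open>a \<noteq> b\<close>, the left side is 1 at \<open>e = a\<close> and
    -1 at \<open>e = b\<close>. On the right a value 1 can come only from the first index, a value
    -1 only from the second.\<close>
  have "a = c" using e[of a] assms(3) by (simp add: of_bool_def split: if_splits)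
  moreover have "b = d" using e[of b] assms(3) by (simp add: of_bool_def split: if_splits)
  ultimately show "a = c \<and> b = d" ..
qed simp

text \<open>In coordinates the sum is e_a - e_b + e_c - e_d, whereas a root has just one entry 1 and
  one entry -1. So something must cancel, \<open>b = c\<close> or \<open>a = d\<close>; then the sum
  is a single \<open>root_ab\<close>, whose indices are determined.\<close>

lemma root_ab_add_eq_root:
  assumes "a \<in> pts n" "b \<in> pts n" "a \<noteq> b" "c \<in> pts n" "d \<in> pts n" "c \<noteq> d"
    and "p \<in> pts n" "q \<in> pts n" "p \<noteq> q"
    and eq: "root_ab \<alpha> a b + root_ab \<alpha> c d = root_ab \<alpha> p q"
  shows "b = c \<and> p = a \<and> q = d \<or> a = d \<and> p = c \<and> q = b"
proof -
  have e: "(of_bool (a = e) - of_bool (b = e)) + (of_bool (c = e) - of_bool (d = e))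
      = (of_bool (p = e) - of_bool (q = e) :: real)" for e
  proof -
    obtain \<epsilon> :: "'v \<Rightarrow> real" where lin: "linear \<epsilon>"
      and \<epsilon>: "\<And>a b. a \<in> pts n \<Longrightarrow> b \<in> pts n \<Longrightarrow>
        \<epsilon> (root_ab \<alpha> a b) = of_bool (a = e) - of_bool (b = e)"
      using coordinate_exists[of e] by blast
    have "\<epsilon> (root_ab \<alpha> a b) + \<epsilon> (root_ab \<alpha> c d) = \<epsilon> (root_ab \<alpha> p q)"
      using arg_cong[OF eq, of \<epsilon>] by (simp only: linear_add[OF lin])
    then show ?thesis by (simp only: \<epsilon> assms(1-9))
  qed
  consider "b = c" | "a = d" | "a \<noteq> d" "b \<noteq> c" by blast
  then show ?thesis
  proof cases
    case 1
    then have "root_ab \<alpha> p q = root_ab \<alpha> a d" using eq by (simp add: root_ab_add)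
    then have "p = a \<and> q = d" by (rule iffD1[OF root_ab_eq_iff, rotated -1]) (fact assms)+
    with 1 show ?thesis by blast
  next
    case 2
    then have "root_ab \<alpha> p q = root_ab \<alpha> c b" using eq by (simp add: root_ab_diff)
    then have "p = c \<and> q = b" by (rule iffD1[OF root_ab_eq_iff, rotated -1]) (fact assms)+
    with 2 show ?thesis by blast
  next
    case 3
    \<comment> \<open>Without cancellation the entries at \<open>a\<close> and at \<open>c\<close>
      are positive on the left. The only positive entry on the right is a 1 at \<open>p\<close>, so
      \<open>p = a = c\<close>; but a common index would produce an entry 2.\<close>
    have "p = a" "c \<noteq> a" using e[of a] 3 assms(3) by (auto simp: of_bool_def split: if_splits)
    moreover have "p = c" using e[of c] 3 assms(6) by (auto simp: of_bool_def split: if_splits)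
    ultimately show ?thesis by simp
  qed
qed

lemma root_ab_in_span_iff:
  assumes D: "D \<subseteq> \<alpha> ` {1..n}" and ab: "a \<in> pts n" "b \<in> pts n"
  shows "root_ab \<alpha> a b \<in> span D \<longleftrightarrow> linked \<alpha> D a b"
proof -
  have up: "root_ab \<alpha> a b \<in> span D \<longleftrightarrow> linked \<alpha> D a b"
    if "1 \<le> a" "a \<le> b" "b \<le> n + 1" for a b
  proof
    assume "linked \<alpha> D a b"
    then have "(\<Sum>l=a..<b. \<alpha> l) \<in> span D"
      by (intro span_sum span_base) (use that in \<open>auto simp: linked_def\<close>)
    then show "root_ab \<alpha> a b \<in> span D" by (simp add: root_ab_def span_0 not_less that)
  next
    assume sp: "root_ab \<alpha> a b \<in> span D"
    show "linked \<alpha> D a b"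
      unfolding linked_def
    proof (intro allI impI, rule ccontr)
      fix k assume k: "min a b \<le> k \<and> k < max a b" and nk: "\<alpha> k \<notin> D"
      \<comment> \<open>\<open>g\<close> reads off the coefficient of \<open>\<alpha> k\<close>: it
        vanishes on \<open>D\<close>, hence on the span, but takes the value 1 on this root.\<close>
      obtain g :: "'v \<Rightarrow> real" where lin: "linear g"
        and g: "\<And>l. l \<in> {1..n} \<Longrightarrow> g (\<alpha> l) = of_bool (l = k)"
        using linear_simple_exists[of "\<lambda>l. of_bool (l = k)"] by blast
      have "g x = 0" if "x \<in> D" for x
        using that D nk g by auto
      then have "g (root_ab \<alpha> a b) = 0"
        using linear_eq_0_on_span[OF lin] sp by blast
      moreover have "g (root_ab \<alpha> a b) = (\<Sum>l=a..<b. g (\<alpha> l))"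
        using that k by (simp add: root_ab_def linear_sum[OF lin])
      moreover have "\<dots> = (\<Sum>l=a..<b. of_bool (l = k))"
        by (rule sum.cong) (use that in \<open>auto simp: g\<close>)
      moreover have "\<dots> = 1" using that k by (simp add: of_bool_def)
      ultimately show False by simp
    qed
  qed
  show ?thesis
  proof (cases "a \<le> b")
    case True
    with up ab show ?thesis by (simp add: pts_def)
  next
    case False
    have "root_ab \<alpha> a b \<in> span D \<longleftrightarrow> root_ab \<alpha> b a \<in> span D"
      by (metis root_ab_minus span_neg)
    with up[of b a] ab False show ?thesis by (simp add: pts_def linked_commute)
  qed
qed

lemma root_ab_in_std_iff:
  assumes "D1 \<subseteq> \<alpha> ` {1..n}" "D2 \<subseteq> \<alpha> ` {1..n}" "a \<in> pts n" "b \<in> pts n" "a \<noteq> b"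
  shows "root_ab \<alpha> a b \<in> std_biclosed n \<alpha> D1 D2 \<longleftrightarrow>
    linked \<alpha> D2 a b \<or> a < b \<and> \<not> linked \<alpha> D1 a b"
proof -
  have "root_ab \<alpha> a b \<in> pos_roots n \<alpha> \<longleftrightarrow> a < b"
    unfolding pos_roots_eq using assms root_ab_eq_iff by auto
  moreover have "root_ab \<alpha> a b \<in> roots n \<alpha>"
    unfolding roots_eq using assms by blast
  ultimately show ?thesis
    using assms by (auto simp: std_biclosed_def root_ab_in_span_iff)
qed

text \<open>A root determines its indices and \<open>\<sigma>\<close> is injective, so only one pair
  can produce the given root of the image.\<close>

lemma root_ab_in_weyl_image_iff:
  assumes \<sigma>: "\<sigma> permutes pts n" and ij: "i \<in> pts n" "j \<in> pts n" "i \<noteq> j"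
  shows "root_ab \<alpha> (\<sigma> i) (\<sigma> j) \<in> weyl_image n \<alpha> \<sigma> S \<longleftrightarrow> root_ab \<alpha> i j \<in> S"
proof
  assume "root_ab \<alpha> (\<sigma> i) (\<sigma> j) \<in> weyl_image n \<alpha> \<sigma> S"
  then obtain a b where ab: "root_ab \<alpha> (\<sigma> i) (\<sigma> j) = root_ab \<alpha> (\<sigma> a) (\<sigma> b)"
    "a \<in> pts n" "b \<in> pts n" "a \<noteq> b" "root_ab \<alpha> a b \<in> S"
    by (auto simp: weyl_image_def)
  moreover have "inj \<sigma>" using \<sigma> by (rule permutes_inj)
  ultimately have "i = a \<and> j = b"
    using root_ab_eq_iff[of "\<sigma> i" "\<sigma> j" "\<sigma> a" "\<sigma> b"] ij permutes_in_image[OF \<sigma>]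
    by (auto simp: inj_eq)
  with ab show "root_ab \<alpha> i j \<in> S" by simp
qed (use ij in \<open>auto simp: weyl_image_def\<close>)

section \<open>Biclosed sets as relations\<close>

text \<open>By \<open>root_ab_add_eq_root\<close> two roots add up to a root only when they chain,
  so closure is transitivity. Opposite roots have sum 0, which is not a root; this is why
  \<open>a \<noteq> c\<close> is demanded.\<close>

lemma closed_roots_iff:
  "closed_roots n \<alpha> C \<longleftrightarrow> C \<subseteq> roots n \<alpha> \<and>
    (\<forall>a\<in>pts n. \<forall>b\<in>pts n. \<forall>c\<in>pts n. a \<noteq> b \<longrightarrow> b \<noteq> c \<longrightarrow> a \<noteq> c \<longrightarrow>
      root_ab \<alpha> a b \<in> C \<longrightarrow> root_ab \<alpha> b c \<in> C \<longrightarrow> root_ab \<alpha> a c \<in> C)"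
    (is "_ \<longleftrightarrow> _ \<and> ?T")
proof
  assume cl: "closed_roots n \<alpha> C"
  have "root_ab \<alpha> a c \<in> C"
    if "a \<in> pts n" "c \<in> pts n" "a \<noteq> c" "root_ab \<alpha> a b \<in> C" "root_ab \<alpha> b c \<in> C" for a b c
  proof -
    have "root_ab \<alpha> a c \<in> roots n \<alpha>" using that unfolding roots_eq by blast
    then have "root_ab \<alpha> a b + root_ab \<alpha> b c \<in> roots n \<alpha>" by (simp only: root_ab_add)
    with cl that(4,5) have "root_ab \<alpha> a b + root_ab \<alpha> b c \<in> C"
      unfolding closed_roots_def by blast
    then show ?thesis by (simp only: root_ab_add)
  qed
  moreover have "C \<subseteq> roots n \<alpha>" using cl unfolding closed_roots_def by (rule conjunct1)
  ultimately show "C \<subseteq> roots n \<alpha> \<and> ?T" by blast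
next
  assume C: "C \<subseteq> roots n \<alpha> \<and> ?T"
  then have tr: "root_ab \<alpha> a c \<in> C"
    if "a \<in> pts n" "b \<in> pts n" "c \<in> pts n" "a \<noteq> b" "b \<noteq> c" "a \<noteq> c"
      "root_ab \<alpha> a b \<in> C" "root_ab \<alpha> b c \<in> C" for a b c
    using that by blast
  have "\<beta> + \<gamma> \<in> C" if \<beta>: "\<beta> \<in> C" and \<gamma>: "\<gamma> \<in> C" and s: "\<beta> + \<gamma> \<in> roots n \<alpha>" for \<beta> \<gamma>
  proof -
    obtain a b where ab: "\<beta> = root_ab \<alpha> a b" "a \<in> pts n" "b \<in> pts n" "a \<noteq> b"
      using \<beta> C unfolding roots_eq by blast
    obtain c d where cd: "\<gamma> = root_ab \<alpha> c d" "c \<in> pts n" "d \<in> pts n" "c \<noteq> d"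
      using \<gamma> C unfolding roots_eq by blast
    obtain p q where pq: "\<beta> + \<gamma> = root_ab \<alpha> p q" "p \<in> pts n" "q \<in> pts n" "p \<noteq> q"
      using s unfolding roots_eq by blast
    have "b = c \<and> p = a \<and> q = d \<or> a = d \<and> p = c \<and> q = b"
      using root_ab_add_eq_root ab cd pq by simp
    then show ?thesis
    \<comment> \<open>The two cases are the two orders in which the summands can chain.\<close>
    proof
      assume e: "b = c \<and> p = a \<and> q = d"
      then have "root_ab \<alpha> a d \<in> C"
        using tr[of a b d] ab cd(1-4) pq(4) \<beta> \<gamma> by blast
      then show ?thesis using pq(1) e by simp
    next
      assume e: "a = d \<and> p = c \<and> q = b"
      then have "root_ab \<alpha> c b \<in> C"
        using tr[of c a b] ab cd(1-4) pq(4) \<beta> \<gamma> by blast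
      then show ?thesis using pq(1) e by simp
    qed
  qed
  then show "closed_roots n \<alpha> C" using C unfolding closed_roots_def by blast
qed

end

text \<open>Only distinct triples are tested, which keeps the diagonal out: \<open>R a a\<close> is
  false when \<open>R\<close> comes from a biclosed set and true when it comes from an operation.
  Both or neither of \<open>R a b\<close> and \<open>R b a\<close> may hold; these are the two kinds
  of ties.\<close>

definition bitransitive_on :: "'a set \<Rightarrow> ('a \<Rightarrow> 'a \<Rightarrow> bool) \<Rightarrow> bool" where
  "bitransitive_on A R \<longleftrightarrow>
    (\<forall>a\<in>A. \<forall>b\<in>A. \<forall>c\<in>A. a \<noteq> b \<longrightarrow> b \<noteq> c \<longrightarrow> a \<noteq> c \<longrightarrow>
      (R a b \<longrightarrow> R b c \<longrightarrow> R a c) \<and> (\<not> R a b \<longrightarrow> \<not> R b c \<longrightarrow> \<not> R a c))"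

lemma bitransitive_onD:
  assumes "bitransitive_on A R" "a \<in> A" "b \<in> A" "c \<in> A" "a \<noteq> b" "b \<noteq> c" "a \<noteq> c"
  shows "R a b \<Longrightarrow> R b c \<Longrightarrow> R a c" "R a c \<Longrightarrow> R a b \<or> R b c"
  using assms unfolding bitransitive_on_def by blast+

lemma bitransitive_on_cong:
  assumes "\<And>a b. a \<in> A \<Longrightarrow> b \<in> A \<Longrightarrow> a \<noteq> b \<Longrightarrow> R a b = Q a b"
  shows "bitransitive_on A R \<longleftrightarrow> bitransitive_on A Q"
  unfolding bitransitive_on_def
  by (intro ball_cong imp_cong conj_cong refl) (simp_all add: assms)

text \<open>Swapping the arguments and negating exchanges the two clauses. This carries results on
  ascending pairs over to descending ones.\<close>

lemma bitransitive_on_dual: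
  assumes "bitransitive_on A R"
  shows "bitransitive_on A (\<lambda>a b. \<not> R b a)"
  unfolding bitransitive_on_def
proof (intro ballI impI)
  fix a b c assume "a \<in> A" "b \<in> A" "c \<in> A" "a \<noteq> b" "b \<noteq> c" "a \<noteq> c"
  then show "(\<not> R b a \<longrightarrow> \<not> R c b \<longrightarrow> \<not> R c a) \<and> (\<not> \<not> R b a \<longrightarrow> \<not> \<not> R c b \<longrightarrow> \<not> \<not> R c a)"
    using bitransitive_onD[OF assms, of c b a] by blast
qed

lemma bitransitive_on_compose:
  assumes "bitransitive_on A R" "inj_on f B" "f ` B \<subseteq> A"
  shows "bitransitive_on B (\<lambda>a b. R (f a) (f b))"
  unfolding bitransitive_on_def
proof (intro ballI impI)
  fix a b c assume abc: "a \<in> B" "b \<in> B" "c \<in> B" "a \<noteq> b" "b \<noteq> c" "a \<noteq> c"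
  then have "f a \<in> A" "f b \<in> A" "f c \<in> A" "f a \<noteq> f b" "f b \<noteq> f c" "f a \<noteq> f c"
    using assms(2,3) by (auto simp: inj_on_eq_iff)
  then show "(R (f a) (f b) \<longrightarrow> R (f b) (f c) \<longrightarrow> R (f a) (f c)) \<and>
      (\<not> R (f a) (f b) \<longrightarrow> \<not> R (f b) (f c) \<longrightarrow> \<not> R (f a) (f c))"
    using bitransitive_onD[OF assms(1), of "f a" "f b" "f c"] by blast
qed

lemma (in root_system_A) biclosed_iff:
  "C \<in> biclosed_sets n \<alpha> \<longleftrightarrow>
    C \<subseteq> roots n \<alpha> \<and> bitransitive_on (pts n) (\<lambda>a b. root_ab \<alpha> a b \<in> C)"
proof -
  have compl: "root_ab \<alpha> a b \<in> roots n \<alpha> - C \<longleftrightarrow> root_ab \<alpha> a b \<notin> C"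
    if "a \<in> pts n" "b \<in> pts n" "a \<noteq> b" for a b
    using that unfolding roots_eq by blast
  have "closed_roots n \<alpha> (roots n \<alpha> - C) \<longleftrightarrow>
    (\<forall>a\<in>pts n. \<forall>b\<in>pts n. \<forall>c\<in>pts n. a \<noteq> b \<longrightarrow> b \<noteq> c \<longrightarrow> a \<noteq> c \<longrightarrow>
      root_ab \<alpha> a b \<notin> C \<longrightarrow> root_ab \<alpha> b c \<notin> C \<longrightarrow> root_ab \<alpha> a c \<notin> C)"
    by (simp only: closed_roots_iff Diff_subset simp_thms) (intro ball_cong imp_cong refl compl)
  then show ?thesis
    unfolding biclosed_sets_def mem_Collect_eq bitransitive_on_def closed_roots_iff[of C] by blast
qed

section \<open>Existence of presentations\<close>

lemma exists_sorting_permutation: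
  fixes key :: "nat \<Rightarrow> nat"
  obtains \<sigma> where "\<sigma> permutes {1..m}"
    "\<And>i j. 1 \<le> i \<Longrightarrow> i \<le> j \<Longrightarrow> j \<le> m \<Longrightarrow> key (\<sigma> i) \<le> key (\<sigma> j)"
proof -
  define xs where "xs = sort_key key [1..<Suc m]"
  \<comment> \<open>Points start at 1 and list positions at 0, hence the shift; outside
    \<open>{1..m}\<close> the map is the identity, as \<open>permutes\<close> demands.\<close>
  define \<sigma> where "\<sigma> i = (if i \<in> {1..m} then xs ! (i - 1) else i)" for i
  have len: "length xs = m" and "distinct xs" and set: "set xs = {1..m}"
    by (auto simp: xs_def)
  then have "bij_betw ((!) xs) {..<m} {1..m}" by (intro bij_betw_nth) auto
  moreover have "bij_betw (\<lambda>i. i - 1) {1..m} {..<m}"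
    by (rule bij_betw_byWitness[where f' = Suc]) auto
  ultimately have "bij_betw (\<lambda>i. xs ! (i - 1)) {1..m} {1..m}"
    using bij_betw_trans by (fastforce simp: comp_def)
  then have "bij_betw \<sigma> {1..m} {1..m}"
    by (subst bij_betw_cong[where g = "\<lambda>i. xs ! (i - 1)"]) (auto simp: \<sigma>_def)
  then have "\<sigma> permutes {1..m}" by (rule bij_imp_permutes) (auto simp: \<sigma>_def)
  moreover have "key (\<sigma> i) \<le> key (\<sigma> j)" if "1 \<le> i" "i \<le> j" "j \<le> m" for i j
  proof -
    have "sorted (map key xs)" by (simp add: xs_def)
    then show ?thesis
      using sorted_nth_mono[of "map key xs" "i - 1" "j - 1"] that len by (simp add: \<sigma>_def)
  qed
  ultimately show thesis using that by blast
qed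

text \<open>The number of points strictly below a point increases strictly along the strict part of
  \<open>R\<close>. Sorting by it therefore leaves no pair whose strict relation points
  backwards.\<close>

lemma sort_bitransitive:
  fixes R :: "nat \<Rightarrow> nat \<Rightarrow> bool"
  assumes R: "bitransitive_on {1..m} R"
  obtains \<sigma> where "\<sigma> permutes {1..m}"
    "\<And>i j. 1 \<le> i \<Longrightarrow> i < j \<Longrightarrow> j \<le> m \<Longrightarrow> R (\<sigma> j) (\<sigma> i) \<Longrightarrow> R (\<sigma> i) (\<sigma> j)"
proof -
  define below where "below x = {y \<in> {1..m}. R y x \<and> \<not> R x y}" for x
  \<comment> \<open>\<open>below y\<close> is contained in \<open>below x\<close> by transitivity of
    \<open>R\<close>, and \<open>y\<close> itself lies only in the latter.\<close>
  have mono: "card (below y) < card (below x)" if y: "y \<in> below x" and x: "x \<in> {1..m}" for x y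
  proof (rule psubset_card_mono)
    show "finite (below x)" unfolding below_def by simp
    have "z \<in> below x" if "z \<in> below y" for z
    proof -
      have "y \<noteq> x" "z \<noteq> y" "z \<noteq> x" "y \<in> {1..m}" "z \<in> {1..m}"
        using that y by (auto simp: below_def)
      with x y that show ?thesis
        using bitransitive_onD(1)[OF R, of z y x] bitransitive_onD(1)[OF R, of x z y]
        by (auto simp: below_def)
    qed
    moreover have "y \<notin> below y" by (simp add: below_def)
    ultimately show "below y \<subset> below x" using y by blast
  qed
  obtain \<sigma> where \<sigma>: "\<sigma> permutes {1..m}"
    "\<And>i j. 1 \<le> i \<Longrightarrow> i \<le> j \<Longrightarrow> j \<le> m \<Longrightarrow> card (below (\<sigma> i)) \<le> card (below (\<sigma> j))"
    using exists_sorting_permutation[of m "\<lambda>x. card (below x)"] by blast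
  have "R (\<sigma> i) (\<sigma> j)" if ij: "1 \<le> i" "i < j" "j \<le> m" "R (\<sigma> j) (\<sigma> i)" for i j
  proof (rule ccontr)
    have in_m: "\<sigma> i \<in> {1..m}" "\<sigma> j \<in> {1..m}"
      using ij by (simp_all only: permutes_in_image[OF \<sigma>(1)]) auto
    assume "\<not> R (\<sigma> i) (\<sigma> j)"
    then have "\<sigma> j \<in> below (\<sigma> i)" using in_m ij by (simp add: below_def)
    from mono[OF this in_m(1)] \<sigma>(2)[of i j] ij show False by simp
  qed
  with \<sigma> show thesis using that by blast
qed

text \<open>If all steps fail, transitivity of the complement propagates the failure to the whole
  pair. A single step that holds is stretched first to the left down to \<open>i\<close>, then to
  the right up to \<open>j\<close>; sortedness turns around every descending pair that
  appears.\<close>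

lemma sorted_bitransitive_iff:
  assumes S: "bitransitive_on {1..m} S"
    and sorted: "\<And>i j. 1 \<le> i \<Longrightarrow> i < j \<Longrightarrow> j \<le> m \<Longrightarrow> S j i \<Longrightarrow> S i j"
    and ij: "1 \<le> i" "i < j" "j \<le> m"
  shows "S i j \<longleftrightarrow> (\<exists>k. i \<le> k \<and> k < j \<and> S k (Suc k))"
proof
  have "\<not> S i j" if "\<forall>k. i \<le> k \<and> k < j \<longrightarrow> \<not> S k (Suc k)"
    using ij(2,3) that
  proof (induction j)
    case (Suc j)
    show ?case
    proof (cases "i = j")
      case False
      with Suc have "\<not> S i j" "\<not> S j (Suc j)" by auto
      with bitransitive_onD(2)[OF S, of i j "Suc j"] False Suc.prems ij(1) show ?thesis by auto
    qed (use Suc in auto)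
  qed simp
  then show "S i j \<Longrightarrow> \<exists>k. i \<le> k \<and> k < j \<and> S k (Suc k)" by blast
next
  assume "\<exists>k. i \<le> k \<and> k < j \<and> S k (Suc k)"
  then obtain k where k: "i \<le> k" "k < j" "S k (Suc k)" by blast
  \<comment> \<open>The stretch to the left: one of \<open>k\<close> and \<open>Suc k\<close> serves
    as \<open>l\<close>.\<close>
  have "\<exists>l. i < l \<and> l \<le> j \<and> S i l"
  proof (cases "k = i")
    case True
    with k show ?thesis by (intro exI[of _ "Suc k"]) auto
  next
    case False
    then have "S k i \<or> S i (Suc k)"
      using bitransitive_onD(2)[OF S, of k i "Suc k"] k ij by auto
    then show ?thesis using sorted[of i k] k ij False by (metis Suc_leI le_neq_implies_less
      less_imp_le_nat less_Suc_eq_le order_le_less_trans)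
  qed
  then obtain l where l: "i < l" "l \<le> j" "S i l" by blast
  show "S i j"
  proof (cases "l = j")
    case False
    then have "S i j \<or> S j l" using bitransitive_onD(2)[OF S, of i j l] l ij by auto
    then have "S i j \<or> S l j" using sorted[of l j] l ij False by auto
    then show ?thesis using bitransitive_onD(1)[OF S, of i l j] l ij False by auto
  qed (use l in simp)
qed

context root_system_A
begin

text \<open>The half of the classification of biclosed sets that gives the description in
  \<open>qt_of_biclosed\<close> a candidate.\<close>

lemma presentation_exists:
  assumes "C \<in> biclosed_sets n \<alpha>"
  shows "\<exists>\<sigma> D1 D2. \<sigma> permutes pts n \<and> orthogonal_simple n \<alpha> form D1 D2 \<and>
    C = weyl_image n \<alpha> \<sigma> (std_biclosed n \<alpha> D1 D2)"
proof -
  have C: "C \<subseteq> roots n \<alpha>" and R: "bitransitive_on {1..n+1} (\<lambda>a b. root_ab \<alpha> a b \<in> C)"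
    using assms by (simp_all add: biclosed_iff pts_def)
  obtain \<sigma> where \<sigma>: "\<sigma> permutes {1..n+1}"
    and srt: "\<And>i j. 1 \<le> i \<Longrightarrow> i < j \<Longrightarrow> j \<le> n+1 \<Longrightarrow>
      root_ab \<alpha> (\<sigma> j) (\<sigma> i) \<in> C \<Longrightarrow> root_ab \<alpha> (\<sigma> i) (\<sigma> j) \<in> C"
    using sort_bitransitive[OF R] by blast
  define S where "S i j \<longleftrightarrow> root_ab \<alpha> (\<sigma> i) (\<sigma> j) \<in> C" for i j
  have S: "bitransitive_on {1..n+1} S"
    unfolding S_def
    by (rule bitransitive_on_compose[OF R permutes_inj_on[OF \<sigma>]]) (simp only: permutes_image[OF \<sigma>] order_refl)
  have sorted: "S i j" if "1 \<le> i" "i < j" "j \<le> n+1" "S j i" for i j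
    using srt[of i j] that unfolding S_def by blast
  \<comment> \<open>After sorting, the step from \<open>k\<close> to \<open>Suc k\<close> is of one
    of three kinds: related in neither direction (\<open>D1\<close>), in both (\<open>D2\<close>),
    or only upwards. By sortedness the single conditions written here imply the full ones.\<close>
  define D1 where "D1 = \<alpha> ` {k \<in> {1..n}. \<not> S k (Suc k)}"
  define D2 where "D2 = \<alpha> ` {k \<in> {1..n}. S (Suc k) k}"
  have D1: "\<alpha> k \<in> D1 \<longleftrightarrow> \<not> S k (Suc k)" and D2: "\<alpha> k \<in> D2 \<longleftrightarrow> S (Suc k) k"
    if "k \<in> {1..n}" for k
    unfolding D1_def D2_def
    using that by (simp_all add: inj_on_image_mem_iff[OF inj_simple that] subset_iff)
  \<comment> \<open>A \<open>D1\<close> step and a \<open>D2\<close> step neither coincide nor share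
    a point. If they shared one, bitransitivity on the three points would lead through the
    \<open>D2\<close> pair to \<open>S (Suc p) p\<close>, contrary to the choice of
    \<open>p\<close>. So the indices differ by at least 2.\<close>
  have form0: "form (\<alpha> p) (\<alpha> q) = 0"
    if pq: "p \<in> {1..n}" "q \<in> {1..n}" "\<not> S p (Suc p)" "S (Suc q) q" for p q
  proof -
    have p: "\<not> S (Suc p) p" and q: "S q (Suc q)"
      using sorted[of p "Suc p"] sorted[of q "Suc q"] pq by auto
    have "p \<noteq> q" using pq q by auto
    moreover have "q \<noteq> Suc p"
    proof
      assume e: "q = Suc p"
      then have "S (Suc q) p"
        using bitransitive_onD(2)[OF S, of "Suc q" p q] pq by auto
      then have "S q p"
        using bitransitive_onD(1)[OF S, of q "Suc q" p] q e pq by auto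
      with p e show False by simp
    qed
    moreover have "p \<noteq> Suc q"
    proof
      assume e: "p = Suc q"
      then have "S (Suc p) q"
        using bitransitive_onD(2)[OF S, of p q "Suc p"] bitransitive_onD(2)[OF S, of p "Suc p" q] pq by auto
      then have "S (Suc p) p"
        using bitransitive_onD(1)[OF S, of "Suc p" q p] q e pq by auto
      with p show False by simp
    qed
    ultimately have "\<bar>int p - int q\<bar> \<ge> 2" by linarith
    with pq show ?thesis by (intro form_distant)
  qed
  have sub: "D1 \<subseteq> \<alpha> ` {1..n}" "D2 \<subseteq> \<alpha> ` {1..n}" by (auto simp: D1_def D2_def)
  have orth: "orthogonal_simple n \<alpha> form D1 D2"
    unfolding orthogonal_simple_def using sub form0 by (auto simp: D1_def D2_def)
  have S_std: "S i j \<longleftrightarrow> root_ab \<alpha> i j \<in> std_biclosed n \<alpha> D1 D2"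
    if ij: "i \<in> pts n" "j \<in> pts n" "i \<noteq> j" for i j
  proof -
    have "S i j \<longleftrightarrow> linked \<alpha> D2 i j \<or> i < j \<and> \<not> linked \<alpha> D1 i j"
    proof (cases "i < j")
      case True
      have D1': "linked \<alpha> D1 i j \<longleftrightarrow> (\<forall>k. i \<le> k \<and> k < j \<longrightarrow> \<not> S k (Suc k))"
        using True ij D1 by (auto simp: linked_def pts_def)
      have "S i j \<longleftrightarrow> \<not> linked \<alpha> D1 i j"
        unfolding D1' using sorted_bitransitive_iff[OF S sorted, of i j] True ij
        by (auto simp: pts_def)
      moreover have "\<not> linked \<alpha> D1 i j" if "linked \<alpha> D2 i j"
      proof -
        have "S (Suc i) i" using that True ij D2[of i] by (auto simp: linked_def pts_def)
        then have "S i (Suc i)" using sorted[of i "Suc i"] True ij by (auto simp: pts_def)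
        then show ?thesis unfolding D1' using True by blast
      qed
      ultimately show ?thesis using True by blast
    next
      case False
      then have ji: "1 \<le> j" "j < i" "i \<le> n + 1" using ij by (auto simp: pts_def)
      have D2': "linked \<alpha> D2 i j \<longleftrightarrow> (\<forall>k. j \<le> k \<and> k < i \<longrightarrow> S (Suc k) k)"
        using ji D2 by (auto simp: linked_def)
      \<comment> \<open>The dual relation is again bitransitive and sorted, so the criterion for
        ascending pairs applies to it with \<open>j < i\<close>.\<close>
      have "\<not> S i j \<longleftrightarrow> (\<exists>k. j \<le> k \<and> k < i \<and> \<not> S (Suc k) k)"
        by (rule sorted_bitransitive_iff[OF bitransitive_on_dual[OF S] _ ji]) (use sorted in blast)
      then show ?thesis using D2' False by blast
    qed
    then show ?thesis by (simp only: root_ab_in_std_iff[OF sub ij])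
  qed
  have \<sigma>': "\<sigma> permutes pts n" using \<sigma> by (simp add: pts_def)
  have "C = weyl_image n \<alpha> \<sigma> (std_biclosed n \<alpha> D1 D2)"
  proof (intro equalityI subsetI)
    fix x assume x: "x \<in> C"
    with C obtain a b where ab: "x = root_ab \<alpha> a b" "a \<in> pts n" "b \<in> pts n" "a \<noteq> b"
      unfolding roots_eq by blast
    then obtain i j where ij: "a = \<sigma> i" "b = \<sigma> j" "i \<in> pts n" "j \<in> pts n"
      using permutes_image[OF \<sigma>'] by blast
    with ab have "i \<noteq> j" by blast
    moreover have "S i j" using x ab ij by (simp add: S_def)
    ultimately show "x \<in> weyl_image n \<alpha> \<sigma> (std_biclosed n \<alpha> D1 D2)"
      unfolding weyl_image_def using ab(1) ij S_std by blast
  next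
    fix x assume "x \<in> weyl_image n \<alpha> \<sigma> (std_biclosed n \<alpha> D1 D2)"
    then show "x \<in> C"
      unfolding weyl_image_def using S_std S_def by blast
  qed
  with \<sigma>' orth show ?thesis by blast
qed

section \<open>The operation of a biclosed set\<close>

text \<open>The form of the operation that mentions no presentation. On the diagonal the two
  branches agree.\<close>

definition qt_of_roots :: "'v set \<Rightarrow> nat \<times> nat \<Rightarrow> nat" where
  "qt_of_roots C = restrict (\<lambda>(x, y). if root_ab \<alpha> x y \<in> C then y else x) (pts n \<times> pts n)"

text \<open>Equal or adjacent simple roots have nonzero form, so orthogonality forbids one in
  \<open>D1\<close> and the other in \<open>D2\<close>. A run inside \<open>D1 \<union> D2\<close>
  therefore never changes sides.\<close>

lemma orthogonal_linked_const:
  assumes orth: "orthogonal_simple n \<alpha> form D1 D2" and p: "1 \<le> p" and q: "q \<le> n + 1"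
    and D: "\<And>l. p \<le> l \<Longrightarrow> l < q \<Longrightarrow> \<alpha> l \<in> D1 \<union> D2"
    and l: "p \<le> l" "l < q"
  shows "\<alpha> l \<in> D1 \<longleftrightarrow> \<alpha> p \<in> D1" "\<alpha> l \<in> D2 \<longleftrightarrow> \<alpha> l \<notin> D1"
proof -
  have ne: "form (\<alpha> i) (\<alpha> j) \<noteq> 0" if "i \<in> {1..n}" "j \<in> {1..n}" "\<bar>int i - int j\<bar> \<le> 1" for i j
  proof -
    have "i = j \<or> \<bar>int i - int j\<bar> = 1" using that(3) by arith
    then show ?thesis
    proof
      assume "i = j"
      with that(1) form_same show ?thesis by simp
    next
      assume "\<bar>int i - int j\<bar> = 1"
      with form_adjacent[OF that(1,2)] show ?thesis by simp
    qed
  qed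
  have excl: "\<not> (\<alpha> i \<in> D1 \<and> \<alpha> j \<in> D2)"
    if "i \<in> {1..n}" "j \<in> {1..n}" "\<bar>int i - int j\<bar> \<le> 1" for i j
    using ne[OF that] orth unfolding orthogonal_simple_def by blast
  show "\<alpha> l \<in> D2 \<longleftrightarrow> \<alpha> l \<notin> D1"
    using D[OF l] excl[of l l] l p q by auto
  show "\<alpha> l \<in> D1 \<longleftrightarrow> \<alpha> p \<in> D1"
    using l
  proof (induction l rule: dec_induct)
    case (step m)
    then have "\<alpha> m \<in> D1 \<union> D2" "\<alpha> (Suc m) \<in> D1 \<union> D2"
      using D[of m] D[of "Suc m"] by simp_all
    moreover have "m \<in> {1..n}" "Suc m \<in> {1..n}" using step p q by auto
    ultimately have "\<alpha> (Suc m) \<in> D1 \<longleftrightarrow> \<alpha> m \<in> D1"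
      using excl[of m "Suc m"] excl[of "Suc m" m] by auto
    with step show ?case by simp
  qed simp
qed

text \<open>Within a block, the left side tests all steps of the block, while the right side tests
  only those between \<open>i\<close> and \<open>j\<close>. The tests agree because the side is
  constant on a block, so that the step at \<open>min i j\<close> decides both.\<close>

lemma qt_of_data_eq:
  assumes \<sigma>: "\<sigma> permutes pts n" and orth: "orthogonal_simple n \<alpha> form D1 D2"
  shows "qt_of_data n \<alpha> D1 D2 \<sigma> = qt_of_roots (weyl_image n \<alpha> \<sigma> (std_biclosed n \<alpha> D1 D2))"
    (is "_ = qt_of_roots ?C")
proof -
  let ?D = "D1 \<union> D2"
  have sub: "D1 \<subseteq> \<alpha> ` {1..n}" "D2 \<subseteq> \<alpha> ` {1..n}"
    using orth by (auto simp: orthogonal_simple_def)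
  have inj: "inj \<sigma>" using \<sigma> by (rule permutes_inj)
  have le: "block_preorder n \<alpha> ?D \<sigma> (\<sigma> i) (\<sigma> j) \<longleftrightarrow> i \<le> j \<or> linked \<alpha> ?D i j"
    if "i \<in> pts n" "j \<in> pts n" for i j
    unfolding block_preorder_def using that block_eq_iff[OF that] by (auto simp: inj_eq[OF inj])
  have eq: "qt_of_data n \<alpha> D1 D2 \<sigma> (\<sigma> i, \<sigma> j) = qt_of_roots ?C (\<sigma> i, \<sigma> j)"
    if ij: "i \<in> pts n" "j \<in> pts n" for i j
  proof (cases "i = j")
    case True
    with ij show ?thesis
      by (simp add: qt_of_data_def qt_of_roots_def permutes_in_image[OF \<sigma>] Let_def)
  next
    case False
    define I where "I = block n \<alpha> ?D i"
    have data: "qt_of_data n \<alpha> D1 D2 \<sigma> (\<sigma> i, \<sigma> j) =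
      (if linked \<alpha> ?D i j
       then (if \<forall>k. k \<in> I \<and> k + 1 \<in> I \<longrightarrow> \<alpha> k \<in> D1 then \<sigma> i else \<sigma> j)
       else if i < j then \<sigma> j else \<sigma> i)"
      using ij False le[OF ij] le[OF ij(2,1)] linked_commute[of \<alpha> ?D i j]
      by (auto simp: qt_of_data_def permutes_in_image[OF \<sigma>] Let_def inv_f_f[OF inj] I_def)
    have roots: "qt_of_roots ?C (\<sigma> i, \<sigma> j) =
      (if linked \<alpha> D2 i j \<or> i < j \<and> \<not> linked \<alpha> D1 i j then \<sigma> j else \<sigma> i)"
      using ij False
      by (simp add: qt_of_roots_def permutes_in_image[OF \<sigma>] root_ab_in_weyl_image_iff[OF \<sigma>]
          root_ab_in_std_iff[OF sub])
    show ?thesis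
    proof (cases "linked \<alpha> ?D i j")
      \<comment> \<open>Different blocks: neither \<open>D1\<close> nor \<open>D2\<close> links the
        points, and both sides choose according to \<open>i < j\<close>.\<close>
      case not_linked: False
      then have "\<not> linked \<alpha> D1 i j" "\<not> linked \<alpha> D2 i j" by (auto simp: linked_def)
      with not_linked show ?thesis by (simp add: data roots)
    next
      case lnk: True
      define p where "p = min i j"
      define q where "q = max i j"
      have pq: "1 \<le> p" "p < q" "q \<le> n + 1"
        using ij False by (auto simp: p_def q_def pts_def)
      have D: "\<alpha> l \<in> ?D" if "p \<le> l" "l < q" for l
        using lnk that by (simp add: linked_def p_def q_def)
      note const = orthogonal_linked_const[OF orth pq(1,3) D]
      have D1: "linked \<alpha> D1 i j \<longleftrightarrow> \<alpha> p \<in> D1"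
        unfolding linked_def p_def[symmetric] q_def[symmetric] using const(1) pq(2) by blast
      have D2: "linked \<alpha> D2 i j \<longleftrightarrow> \<alpha> p \<notin> D1"
        unfolding linked_def p_def[symmetric] q_def[symmetric]
        using const pq(2) order_refl by blast
      have "(\<forall>k. k \<in> I \<and> k + 1 \<in> I \<longrightarrow> \<alpha> k \<in> D1) \<longleftrightarrow> \<alpha> p \<in> D1"
      proof
        assume all: "\<forall>k. k \<in> I \<and> k + 1 \<in> I \<longrightarrow> \<alpha> k \<in> D1"
        have "m \<in> I" if m: "p \<le> m" "m \<le> q" for m
        proof -
          have "p \<le> k \<and> k < q" if "min i m \<le> k \<and> k < max i m" for k
            using that m unfolding p_def q_def by linarith
          moreover have "m \<in> pts n" using m pq unfolding pts_def by simp
          ultimately show ?thesis using D unfolding I_def block_def by blast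
        qed
        then have "p \<in> I" "p + 1 \<in> I" using pq(2) by simp_all
        with all show "\<alpha> p \<in> D1" by blast
      next
        assume p: "\<alpha> p \<in> D1"
        show "\<forall>k. k \<in> I \<and> k + 1 \<in> I \<longrightarrow> \<alpha> k \<in> D1"
        proof (intro allI impI, elim conjE)
          fix k assume k: "k \<in> I" "k + 1 \<in> I"
          \<comment> \<open>The range from \<open>p'\<close> to \<open>q'\<close> contains the steps
            between \<open>i\<close> and \<open>j\<close> as well as the step \<open>k\<close>. Each
            of its steps lies between \<open>i\<close> and another point of the block, hence belongs
            to \<open>?D\<close>, and the side is the same at \<open>p\<close> and at
            \<open>k\<close>.\<close>
          define p' where "p' = min p k"
          define q' where "q' = max q (k + 1)"
          have p'q': "1 \<le> p'" "q' \<le> n + 1"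
            using pq k by (auto simp: p'_def q'_def I_def block_def pts_def)
          have D': "\<alpha> l \<in> ?D" if l: "p' \<le> l" "l < q'" for l
          proof -
            have "p \<le> l \<and> l < q \<or> min i k \<le> l \<and> l < max i k
                \<or> min i (k + 1) \<le> l \<and> l < max i (k + 1)"
              using l unfolding p'_def q'_def p_def q_def by linarith
            then show ?thesis
              using D k unfolding I_def block_def by blast
          qed
          note const' = orthogonal_linked_const(1)[OF orth p'q' D']
          from const'[of p] const'[of k] p pq(2) show "\<alpha> k \<in> D1"
            by (auto simp: p'_def q'_def)
        qed
      qed
      with lnk D1 D2 show ?thesis by (auto simp: data roots)
    qed
  qed
  show ?thesis
  proof
    fix z :: "nat \<times> nat"
    show "qt_of_data n \<alpha> D1 D2 \<sigma> z = qt_of_roots ?C z"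
    proof (cases "z \<in> pts n \<times> pts n")
      case True
      then have "z \<in> \<sigma> ` pts n \<times> \<sigma> ` pts n" by (simp only: permutes_image[OF \<sigma>])
      then obtain i j where "z = (\<sigma> i, \<sigma> j)" "i \<in> pts n" "j \<in> pts n" by blast
      with eq show ?thesis by simp
    next
      case False
      then show ?thesis unfolding qt_of_data_def qt_of_roots_def by (simp only: restrict_def if_False)
    qed
  qed
qed

text \<open>\<open>presentation_exists\<close> supplies a value for the description, and by
  \<open>qt_of_data_eq\<close> all presentations of \<open>C\<close> give the same one.\<close>

lemma qt_of_biclosed_eq:
  assumes "C \<in> biclosed_sets n \<alpha>"
  shows "qt_of_biclosed n \<alpha> form C = qt_of_roots C"
  unfolding qt_of_biclosed_def
proof (rule the_equality)
  show "\<exists>\<sigma> \<Delta>1 \<Delta>2. \<sigma> permutes pts n \<and> orthogonal_simple n \<alpha> form \<Delta>1 \<Delta>2 \<and>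
      C = weyl_image n \<alpha> \<sigma> (std_biclosed n \<alpha> \<Delta>1 \<Delta>2) \<and> qt_of_roots C = qt_of_data n \<alpha> \<Delta>1 \<Delta>2 \<sigma>"
    using presentation_exists[OF assms] qt_of_data_eq[symmetric] by blast
next
  fix F assume "\<exists>\<sigma> \<Delta>1 \<Delta>2. \<sigma> permutes pts n \<and> orthogonal_simple n \<alpha> form \<Delta>1 \<Delta>2 \<and>
      C = weyl_image n \<alpha> \<sigma> (std_biclosed n \<alpha> \<Delta>1 \<Delta>2) \<and> F = qt_of_data n \<alpha> \<Delta>1 \<Delta>2 \<sigma>"
  then show "F = qt_of_roots C" using qt_of_data_eq by blast
qed

end

section \<open>Quasitrivial semigroups\<close>

text \<open>On distinct \<open>a\<close>, \<open>b\<close>, \<open>c\<close>, when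
  \<open>F (a, b)\<close> and \<open>F (b, c)\<close> are both right factors or both left factors,
  associativity amounts to the same choice for \<open>F (a, c)\<close>; in the two mixed cases it is
  automatic. Triples with a repetition associate by quasitriviality alone.\<close>

lemma quasitrivial_semigroups_iff:
  "F \<in> quasitrivial_semigroups S \<longleftrightarrow>
    F \<in> extensional (S \<times> S) \<and> (\<forall>a\<in>S. \<forall>b\<in>S. F (a, b) \<in> {a, b}) \<and>
    bitransitive_on S (\<lambda>a b. F (a, b) = b)"
    (is "_ \<longleftrightarrow> ?R")
proof
  assume F: "F \<in> quasitrivial_semigroups S"
  have ext: "F \<in> extensional (S \<times> S)"
    and qt: "\<And>a b. a \<in> S \<Longrightarrow> b \<in> S \<Longrightarrow> F (a, b) = a \<or> F (a, b) = b"
    and assoc: "\<And>a b c. a \<in> S \<Longrightarrow> b \<in> S \<Longrightarrow> c \<in> S \<Longrightarrow> F (F (a, b), c) = F (a, F (b, c))"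
    using F by (auto simp: quasitrivial_semigroups_def PiE_def)
  have "bitransitive_on S (\<lambda>a b. F (a, b) = b)"
    unfolding bitransitive_on_def
  proof (intro ballI impI conjI)
    fix a b c assume "a \<in> S" "b \<in> S" "c \<in> S" "F (a, b) = b" "F (b, c) = c"
    then show "F (a, c) = c" using assoc[of a b c] by simp
  next
    fix a b c assume abc: "a \<in> S" "b \<in> S" "c \<in> S" "a \<noteq> c" "F (a, b) \<noteq> b" "F (b, c) \<noteq> c"
    then have "F (a, b) = a" "F (b, c) = b" using qt by blast+
    then show "F (a, c) \<noteq> c" using assoc[of a b c] abc by simp
  qed
  with ext qt show ?R by blast
next
  assume ?R
  then have ext: "F \<in> extensional (S \<times> S)"
    and qt: "\<And>a b. a \<in> S \<Longrightarrow> b \<in> S \<Longrightarrow> F (a, b) = a \<or> F (a, b) = b"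
    and bt: "bitransitive_on S (\<lambda>a b. F (a, b) = b)"
    by auto
  have "F (F (a, b), c) = F (a, F (b, c))" if abc: "a \<in> S" "b \<in> S" "c \<in> S" for a b c
  proof -
    have idem: "F (x, x) = x" if "x \<in> S" for x using qt[of x x] that by simp
    consider "a = b" | "b = c" | "a = c" | "a \<noteq> b" "b \<noteq> c" "a \<noteq> c" by blast
    then show ?thesis
    proof cases
      case 4
      note bitransitive_onD[OF bt abc 4]
      then show ?thesis
        using qt[of a b] qt[of b c] qt[of a c] abc 4 by auto
    qed (use abc qt[of a b] qt[of b c] qt[of a c] qt[of b a] idem in auto)
  qed
  moreover have "F \<in> (S \<times> S) \<rightarrow>\<^sub>E S" 
  proof (rule PiE_I)
    fix z assume "z \<in> S \<times> S"
    then show "F z \<in> S" using qt[of "fst z" "snd z"] by (auto simp: mem_Times_iff)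
  qed (rule extensional_arb[OF ext])
  ultimately show "F \<in> quasitrivial_semigroups S"
    using qt by (simp add: quasitrivial_semigroups_def)
qed

lemma quasitrivial_semigroups_eqI:
  assumes F: "F \<in> quasitrivial_semigroups S" and G: "G \<in> quasitrivial_semigroups S"
    and eq: "\<And>a b. a \<in> S \<Longrightarrow> b \<in> S \<Longrightarrow> a \<noteq> b \<Longrightarrow> F (a, b) = b \<longleftrightarrow> G (a, b) = b"
  shows "F = G"
proof (rule extensionalityI[of F "S \<times> S" G])
  fix z assume "z \<in> S \<times> S"
  then obtain a b where z: "z = (a, b)" "a \<in> S" "b \<in> S" by auto
  then have "F (a, b) \<in> {a, b}" "G (a, b) \<in> {a, b}"
    using F G by (auto simp: quasitrivial_semigroups_iff)
  with eq[of a b] z show "F z = G z" by (cases "a = b") auto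
qed (use F G in \<open>simp_all add: quasitrivial_semigroups_iff\<close>)

lemma two_point_order_iff:
  assumes ab: "a \<noteq> b"
    and F: "F (a, a) = a" "F (b, b) = b" "F (a, b) \<in> {a, b}" "F (b, a) \<in> {a, b}"
    and G: "G (a, a) = a" "G (b, b) = b" "G (a, b) \<in> {a, b}" "G (b, a) \<in> {a, b}"
  shows "(restrict F ({a, b} \<times> {a, b}), restrict G ({a, b} \<times> {a, b})) \<in> two_point_order {a, b} \<longleftrightarrow>
    (F (a, b) = b \<longrightarrow> G (a, b) = b) \<and> (F (b, a) = a \<longrightarrow> G (b, a) = a)"
proof -
  have r: "restrict f X = restrict g X \<longleftrightarrow> (\<forall>x\<in>X. f x = g x)" for f g :: "nat \<times> nat \<Rightarrow> nat" and X
    by (metis restrict_apply' restrict_ext)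
  \<comment> \<open>For \<open>a < b\<close> the operation with \<open>F (a, b) = b\<close> and
    \<open>F (b, a) = b\<close> is \<open>max\<close> and the one with both values \<open>a\<close>
    is \<open>min\<close>; for \<open>b < a\<close> the two are exchanged.\<close>
  have "a < b \<or> b < a" using ab by linarith
  then show ?thesis
    using F G ab unfolding two_point_order_def proj1_on_def proj2_on_def max_on_def min_on_def
    by (elim disjE insertE emptyE) (simp_all add: Id_on_iff r max_def min_def)
qed

lemma qt_le_iff:
  assumes F: "F \<in> quasitrivial_semigroups (pts n)" and G: "G \<in> quasitrivial_semigroups (pts n)"
  shows "qt_le n F G \<longleftrightarrow> (\<forall>a\<in>pts n. \<forall>b\<in>pts n. a \<noteq> b \<longrightarrow> F (a, b) = b \<longrightarrow> G (a, b) = b)"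
proof -
  have "(restrict F ({a, b} \<times> {a, b}), restrict G ({a, b} \<times> {a, b})) \<in> two_point_order {a, b} \<longleftrightarrow>
      (F (a, b) = b \<longrightarrow> G (a, b) = b) \<and> (F (b, a) = a \<longrightarrow> G (b, a) = a)"
    if "a \<in> pts n" "b \<in> pts n" "a \<noteq> b" for a b
    by (rule two_point_order_iff)
      (use that F G in \<open>auto simp: quasitrivial_semigroups_iff\<close>)
  then have "qt_le n F G \<longleftrightarrow> (\<forall>a\<in>pts n. \<forall>b\<in>pts n. a \<noteq> b \<longrightarrow>
      (F (a, b) = b \<longrightarrow> G (a, b) = b) \<and> (F (b, a) = a \<longrightarrow> G (b, a) = a))"
    unfolding qt_le_def by (intro ball_cong imp_cong refl)
  \<comment> \<open>The quantifiers range over ordered pairs, so the second implication is the first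
    one for the swapped pair.\<close>
  then show ?thesis by metis
qed

lemma partial_order_qt_le:
  "partial_order_on (quasitrivial_semigroups (pts n))
    (relation_of (qt_le n) (quasitrivial_semigroups (pts n)))"
proof (rule partial_order_on_relation_ofI)
  fix F G assume FG: "F \<in> quasitrivial_semigroups (pts n)" "G \<in> quasitrivial_semigroups (pts n)"
    "qt_le n F G" "qt_le n G F"
  show "F = G"
    using FG(3,4) unfolding qt_le_iff[OF FG(1,2)] qt_le_iff[OF FG(2,1)]
    by (intro quasitrivial_semigroups_eqI[OF FG(1,2)]) blast
qed (simp_all add: qt_le_iff)

section \<open>Order isomorphism between biclosed sets and operations\<close>

context root_system_A
begin

lemma qt_of_roots_eq_snd_iff:
  assumes "x \<in> pts n" "y \<in> pts n" "x \<noteq> y"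
  shows "qt_of_roots C (x, y) = y \<longleftrightarrow> root_ab \<alpha> x y \<in> C"
  using assms by (simp add: qt_of_roots_def)

lemma qt_of_roots_in_quasitrivial_iff:
  assumes "C \<subseteq> roots n \<alpha>"
  shows "qt_of_roots C \<in> quasitrivial_semigroups (pts n) \<longleftrightarrow> C \<in> biclosed_sets n \<alpha>"
proof -
  have "bitransitive_on (pts n) (\<lambda>a b. qt_of_roots C (a, b) = b) \<longleftrightarrow>
      bitransitive_on (pts n) (\<lambda>a b. root_ab \<alpha> a b \<in> C)"
    by (rule bitransitive_on_cong) (rule qt_of_roots_eq_snd_iff)
  then show ?thesis
    using assms by (auto simp: quasitrivial_semigroups_iff biclosed_iff qt_of_roots_def)
qed

lemma subset_iff_qt_le:
  assumes C1: "C1 \<in> biclosed_sets n \<alpha>" and C2: "C2 \<in> biclosed_sets n \<alpha>"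
  shows "C1 \<subseteq> C2 \<longleftrightarrow> qt_le n (qt_of_roots C1) (qt_of_roots C2)"
proof -
  have sub: "C1 \<subseteq> roots n \<alpha>" "C2 \<subseteq> roots n \<alpha>"
    using C1 C2 by (simp_all add: biclosed_iff)
  then have "qt_le n (qt_of_roots C1) (qt_of_roots C2) \<longleftrightarrow>
      (\<forall>a\<in>pts n. \<forall>b\<in>pts n. a \<noteq> b \<longrightarrow> root_ab \<alpha> a b \<in> C1 \<longrightarrow> root_ab \<alpha> a b \<in> C2)"
    using C1 C2 by (simp add: qt_le_iff qt_of_roots_in_quasitrivial_iff qt_of_roots_eq_snd_iff)
  also have "\<dots> \<longleftrightarrow> C1 \<subseteq> C2"
    using sub(1) unfolding roots_eq by blast
  finally show ?thesis by blast
qed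

lemma bij_betw_qt_of_roots:
  "bij_betw qt_of_roots (biclosed_sets n \<alpha>) (quasitrivial_semigroups (pts n))"
proof (rule bij_betw_imageI)
  have in_qt: "qt_of_roots C \<in> quasitrivial_semigroups (pts n)" if "C \<in> biclosed_sets n \<alpha>" for C
    using that qt_of_roots_in_quasitrivial_iff biclosed_iff by blast
  show "inj_on qt_of_roots (biclosed_sets n \<alpha>)"
  proof (rule inj_onI)
    fix C1 C2 assume C: "C1 \<in> biclosed_sets n \<alpha>" "C2 \<in> biclosed_sets n \<alpha>"
      and eq: "qt_of_roots C1 = qt_of_roots C2"
    \<comment> \<open>Injectivity comes from the order embedding: equal images are related in both
      directions by reflexivity.\<close>
    have le: "qt_le n (qt_of_roots C1) (qt_of_roots C1)"
      using subset_iff_qt_le[OF C(1,1)] by blast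
    show "C1 = C2"
    proof
      show "C1 \<subseteq> C2" unfolding subset_iff_qt_le[OF C] eq[symmetric] by (rule le)
      show "C2 \<subseteq> C1" unfolding subset_iff_qt_le[OF C(2,1)] eq[symmetric] by (rule le)
    qed
  qed
  show "qt_of_roots ` biclosed_sets n \<alpha> = quasitrivial_semigroups (pts n)"
  proof (intro equalityI subsetI)
    fix F assume F: "F \<in> quasitrivial_semigroups (pts n)"
    \<comment> \<open>The preimage collects the roots at whose indices \<open>F\<close> picks the
      second argument. As a root determines its indices, membership in \<open>C\<close> gives
      \<open>F\<close> back.\<close>
    define C where "C = {root_ab \<alpha> a b | a b. a \<in> pts n \<and> b \<in> pts n \<and> a \<noteq> b \<and> F (a, b) = b}"
    have sub: "C \<subseteq> roots n \<alpha>" unfolding C_def roots_eq by blast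
    have C: "root_ab \<alpha> a b \<in> C \<longleftrightarrow> F (a, b) = b" if "a \<in> pts n" "b \<in> pts n" "a \<noteq> b" for a b
      using that root_ab_eq_iff[OF that] unfolding C_def by blast
    have "bitransitive_on (pts n) (\<lambda>a b. root_ab \<alpha> a b \<in> C) \<longleftrightarrow>
        bitransitive_on (pts n) (\<lambda>a b. F (a, b) = b)"
      by (rule bitransitive_on_cong) (rule C)
    with sub F have bc: "C \<in> biclosed_sets n \<alpha>"
      by (simp only: biclosed_iff quasitrivial_semigroups_iff simp_thms)
    have "F = qt_of_roots C"
      by (rule quasitrivial_semigroups_eqI[OF F in_qt[OF bc]]) (simp add: qt_of_roots_eq_snd_iff C)
    with bc show "F \<in> qt_of_roots ` biclosed_sets n \<alpha>" by blast
  qed (use in_qt in blast)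
qed

end

theorem lemma3p8:
  fixes n :: nat
    and \<alpha> :: "nat \<Rightarrow> 'v::real_vector"
    and form :: "'v \<Rightarrow> 'v \<Rightarrow> real"
  assumes "root_system_A n \<alpha> form"
  shows "(\<forall>C1\<in>biclosed_sets n \<alpha>. \<forall>C2\<in>biclosed_sets n \<alpha>.
            C1 \<subseteq> C2 \<longleftrightarrow> qt_le n (qt_of_biclosed n \<alpha> form C1) (qt_of_biclosed n \<alpha> form C2))
       \<and> partial_order_on (quasitrivial_semigroups (pts n))
            (relation_of (qt_le n) (quasitrivial_semigroups (pts n)))
       \<and> bij_betw (qt_of_biclosed n \<alpha> form) (biclosed_sets n \<alpha>) (quasitrivial_semigroups (pts n))"
proof -
  interpret root_system_A n \<alpha> form by (rule assms)
  have "bij_betw (qt_of_biclosed n \<alpha> form) (biclosed_sets n \<alpha>) (quasitrivial_semigroups (pts n))"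
    using bij_betw_qt_of_roots by (simp add: qt_of_biclosed_eq cong: bij_betw_cong)
  then show ?thesis
    by (simp add: partial_order_qt_le qt_of_biclosed_eq subset_iff_qt_le)
qed

end
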